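(* In general, the maximum of $|\det A|$ over $n\times n$ circulant matrices $A$ with real entries in $[0,1]$ is not attained at an extreme point of the cube $[0,1]^n$ of first rows. Specifically: (1) For $n = 9$, let $A(x) := \mathrm{circ}(x,0,0,1,1,1,1,0,1)$. Then $\det A(0) = 95 = D_{01}(9)$, the derivative of $\det A(x)$ with respect to $x$ at $x=0$ equals $9$, and $|\det A(0.241)| > 96.757$; hence $\max\{|\det \mathrm{circ}(a)| : a \in [0,1]^9\} > D_{01}(9)$. (2) For $n=10$, let $A(x) := \mathrm{circ}(x,0,1,0,0,1,1,1,1,0)$. Then $\det A(0) = 275 = D_{01}(10)$ and $\det A(0.112) > 279.4$; hence $\max\{|\det \mathrm{circ}(a)| : a \in [0,1]^{10}\} > D_{01}(10)$.
   Context: For a positive integer $n$, $\mathrm{circ}(a_0,\ldots,a_{n-1})$ denotes the $n\times n$ circulant matrix $(a_{(k-j)\bmod n})_{0\le j,k<n}$, whose first row is $a = (a_0,\ldots,a_{n-1})$. $D_{01}(n)$ denotes the maximum of $|\det B|$ over all $n \times n$ circulant matrices $B$ with entries in $\{0,1\}$, i.e. the maximum of $|\det\mathrm{circ}(a)|$ over the extreme points $a\in\{0,1\}^n$ of the cube $[0,1]^n$. *)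

theory Defs
  imports Complex_Main "Jordan_Normal_Form.Determinant"
begin

text \<open>Entry (j, k) is a at index (k - j) mod n; since j < n, adding n first avoids truncated
  subtraction.\<close>

definition circ :: "'a vec \<Rightarrow> 'a mat" where
  "circ a = mat (dim_vec a) (dim_vec a)
     (\<lambda>(j, k). a $ ((k + dim_vec a - j) mod dim_vec a))"

definition unit_cube :: "nat \<Rightarrow> real vec set" where
  "unit_cube n = {a \<in> carrier_vec n. \<forall>i<n. 0 \<le> a $ i \<and> a $ i \<le> 1}"

definition zero_one_vecs :: "nat \<Rightarrow> real vec set" where
  "zero_one_vecs n = {a \<in> carrier_vec n. \<forall>i<n. a $ i \<in> {0, 1}}"

text \<open>The counterpart for \<open>real vec\<close>, which is not an instance of \<open>real_vector\<close>, of
  \<open>extreme_point_of\<close> in HOL-Analysis.\<close>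

definition extreme_point :: "real vec \<Rightarrow> real vec set \<Rightarrow> bool" where
  "extreme_point a S \<longleftrightarrow> a \<in> S \<and>
     \<not> (\<exists>x\<in>S. \<exists>y\<in>S. \<exists>t::real. x \<noteq> y \<and> 0 < t \<and> t < 1 \<and>
          a = (1 - t) \<cdot>\<^sub>v x + t \<cdot>\<^sub>v y)"

text \<open>\<open>Max\<close> is meaningful here: the set ranges over the \<open>2 ^ n\<close> zero-one first rows.\<close>

definition D01 :: "nat \<Rightarrow> real" where
  "D01 n = Max ((\<lambda>a. \<bar>det (circ a)\<bar>) ` zero_one_vecs n)"

definition attains_cube_max :: "nat \<Rightarrow> real vec \<Rightarrow> bool" where
  "attains_cube_max n a \<longleftrightarrow> is_arg_max (\<lambda>b. \<bar>det (circ b)\<bar>) (\<lambda>b. b \<in> unit_cube n) a"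

definition A9 :: "real \<Rightarrow> real mat" where
  "A9 x = circ (vec_of_list [x, 0, 0, 1, 1, 1, 1, 0, 1])"

definition A10 :: "real \<Rightarrow> real mat" where
  "A10 x = circ (vec_of_list [x, 0, 1, 0, 0, 1, 1, 1, 1, 0])"

end

(* The Fourier vectors diagonalise circ(a), so det circ(a) is the product of the values
   P(w^m) of P(x) = a_0 + a_1 x + ... at the n-th roots of unity. Grouping the roots makes this
   an integer polynomial in the entries that is cheap to evaluate. For n = 9, the product of P
   over the cube roots of t is a polynomial in t modulo t^3 - 1, and its values at the three cube
   roots of unity are multiplied in turn; for n = 10, P(x) P(-x) is a polynomial in t = x^2
   modulo t^5 - 1. Evaluating the polynomials at all 0/1 rows gives D01(9) and D01(10). The
   maximum over the cube exists by compactness, and extreme points of the cube are 0/1 rows. *)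
theory Submission
  imports Defs "HOL-Analysis.Function_Topology"
begin

section \<open>Circulant determinants through Fourier diagonalisation\<close>

lemma circ_carrier [simp]: "a \<in> carrier_vec n \<Longrightarrow> circ a \<in> carrier_mat n n"
  by (auto simp: circ_def)

lemma circ_index: "a \<in> carrier_vec n \<Longrightarrow> j < n \<Longrightarrow> k < n \<Longrightarrow> circ a $$ (j, k) = a $ ((k + n - j) mod n)"
  by (auto simp: circ_def)

lemma power_mod_root_of_unity:
  fixes w :: "'a::monoid_mult"
  assumes "w ^ n = 1"
  shows "w ^ (k mod n) = w ^ k"
proof -
  have "w ^ k = w ^ (n * (k div n) + k mod n)" by simp
  also have "\<dots> = w ^ (k mod n)" by (simp only: power_add power_mult assms power_one mult_1_left)
  finally show ?thesis by simp
qed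

lemma sum_powers_root_of_unity:
  fixes z :: "'a::field"
  assumes "z ^ n = 1" "z \<noteq> 1"
  shows "(\<Sum>k<n. z ^ k) = 0"
  using geometric_sum[of z n] assms by simp

text \<open>For \<open>n > 0\<close>, \<open>G\<close> plays the role of the conjugate Fourier
  matrix, with exponent \<open>n - m\<close> in place of \<open>- m\<close>. Orthogonality of
  characters makes \<open>F * G\<close> equal to \<open>n\<close> times the identity, and
  \<open>n ^ n\<close> is nonzero in characteristic 0.\<close>

lemma det_fourier_nonzero:
  fixes w :: "'a::field_char_0"
  assumes w: "w ^ n = 1" and prim: "\<And>k. 0 < k \<Longrightarrow> k < n \<Longrightarrow> w ^ k \<noteq> 1"
  shows "det (mat n n (\<lambda>(k, m). w ^ (k * m))) \<noteq> 0"
proof (cases "n = 0")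
  case False
  define F where "F = mat n n (\<lambda>(k, m). w ^ (k * m))"
  define G where "G = mat n n (\<lambda>(k, m). w ^ (k * (n - m)))"
  have [simp]: "F \<in> carrier_mat n n" "G \<in> carrier_mat n n" by (simp_all add: F_def G_def)
  have "F * G = of_nat n \<cdot>\<^sub>m 1\<^sub>m n"
  proof (rule eq_matI)
    fix i j assume "i < dim_row (of_nat n \<cdot>\<^sub>m 1\<^sub>m n :: 'a mat)" "j < dim_col (of_nat n \<cdot>\<^sub>m 1\<^sub>m n :: 'a mat)"
    then have ij: "i < n" "j < n" by auto
    let ?z = "w ^ (i + (n - j))"
    have zn: "?z ^ n = 1"
      by (metis power_mult mult.commute power_one w)
    have "(F * G) $$ (i, j) = (\<Sum>k<n. ?z ^ k)"
      using ij by (simp add: F_def G_def scalar_prod_def atLeast0LessThan mult.commute algebra_simps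
          flip: power_mult power_add)
    also have "\<dots> = (if i = j then of_nat n else 0)"
    proof (cases "i = j")
      case True
      then show ?thesis using ij w by simp
    next
      case False
      \<comment> \<open>The exponent lies strictly between 0 and \<open>2 * n\<close>, so as a
        multiple of \<open>n\<close> it could only be \<open>n\<close> itself, which forces
        \<open>i = j\<close>.\<close>
      have "(i + (n - j)) mod n \<noteq> 0"
      proof
        assume "(i + (n - j)) mod n = 0"
        then obtain q where q: "i + (n - j) = n * q" by auto
        have "0 < n * q" "n * q < n * 2" using q ij by linarith+
        then have "0 < q" "q < 2" by simp_all
        then have "q = 1" by simp
        with q ij False show False by simp
      qed
      then have "w ^ ((i + (n - j)) mod n) \<noteq> 1"
        using prim[of "(i + (n - j)) mod n"] ij by auto
      then have "?z \<noteq> 1" using power_mod_root_of_unity[OF w] by metis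
      then show ?thesis using sum_powers_root_of_unity[OF zn] False by simp
    qed
    finally show "(F * G) $$ (i, j) = (of_nat n \<cdot>\<^sub>m 1\<^sub>m n) $$ (i, j)" using ij by simp
  qed (auto simp: F_def G_def)
  then have "det F * det G = of_nat n ^ n"
    by (simp add: det_mult[symmetric, of F n G] det_smult)
  then show ?thesis using False by (auto simp: F_def)
qed simp

text \<open>Column \<open>m\<close> of \<open>F\<close> is an eigenvector of \<open>circ a\<close>
  with eigenvalue \<open>ev m\<close>. Hence \<open>circ a * F = F * D\<close>, and after taking
  determinants the nonzero \<open>det F\<close> cancels.\<close>

lemma det_circ_eq_prod:
  fixes w :: "'a::field_char_0"
  assumes a: "a \<in> carrier_vec n"
    and w: "w ^ n = 1" and prim: "\<And>k. 0 < k \<Longrightarrow> k < n \<Longrightarrow> w ^ k \<noteq> 1"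
  shows "det (circ a) = (\<Prod>m<n. \<Sum>i<n. a $ i * (w ^ m) ^ i)"
proof -
  define F where "F = mat n n (\<lambda>(k, m). w ^ (k * m))"
  define ev where "ev = (\<lambda>m. \<Sum>i<n. a $ i * (w ^ m) ^ i)"
  define D where "D = mat n n (\<lambda>(k, m). if k = m then ev m else 0)"
  have [simp]: "F \<in> carrier_mat n n" "D \<in> carrier_mat n n" "circ a \<in> carrier_mat n n"
    using a by (simp_all add: F_def D_def)
  have "circ a * F = F * D"
  proof (rule eq_matI)
    fix j m assume "j < dim_row (F * D)" "m < dim_col (F * D)"
    then have jm: "j < n" "m < n" by (auto simp: F_def D_def)
    have wm: "(w ^ m) ^ n = 1" by (metis power_mult mult.commute power_one w)
    have "(circ a * F) $$ (j, m) = (\<Sum>k<n. circ a $$ (j, k) * F $$ (k, m))"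
      using jm a by (auto simp: scalar_prod_def F_def circ_def atLeast0LessThan)
    also have "\<dots> = (\<Sum>k<n. a $ ((k + n - j) mod n) * (w ^ m) ^ k)"
      using jm a by (intro sum.cong) (auto simp: circ_index F_def mult.commute simp flip: power_mult)
    also have "\<dots> = (\<Sum>i<n. a $ i * (w ^ m) ^ (i + j))"
    \<comment> \<open>Substitute \<open>k = (i + j) mod n\<close>. The exponent may stay
      \<open>i + j\<close> because \<open>w ^ m\<close> is itself an \<open>n\<close>-th root of
      unity.\<close>
    proof (rule sum.reindex_bij_witness[of _ "\<lambda>i. (i + j) mod n" "\<lambda>k. (k + n - j) mod n"])
      fix k assume k: "k \<in> {..<n}"
      have "((k + n - j) mod n + j) mod n = (k + n - j + j) mod n" by (simp add: mod_add_left_eq)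
      then show inv: "((k + n - j) mod n + j) mod n = k" using k jm by simp
      show "(k + n - j) mod n \<in> {..<n}" using jm by auto
      show "a $ ((k + n - j) mod n) * (w ^ m) ^ ((k + n - j) mod n + j) =
          a $ ((k + n - j) mod n) * (w ^ m) ^ k"
        using power_mod_root_of_unity[OF wm] inv by metis
    next
      fix i assume i: "i \<in> {..<n}"
      have "((i + j) mod n + n - j) mod n = ((i + j) mod n + (n - j)) mod n" using jm by simp
      also have "\<dots> = (i + j + (n - j)) mod n" by (simp only: mod_add_left_eq)
      also have "\<dots> = i" using i jm by simp
      finally show "((i + j) mod n + n - j) mod n = i" .
      show "(i + j) mod n \<in> {..<n}" using jm by auto
    qed
    also have "\<dots> = w ^ (j * m) * ev m"
      by (simp add: ev_def sum_distrib_left power_add mult.commute mult.left_commute flip: power_mult)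
    also have "\<dots> = (F * D) $$ (j, m)"
      using jm by (simp add: F_def D_def scalar_prod_def if_distrib cong: if_cong)
    finally show "(circ a * F) $$ (j, m) = (F * D) $$ (j, m)" .
  qed (use a in \<open>auto simp: F_def D_def circ_def\<close>)
  then have "det (circ a) * det F = det F * det D"
    by (simp add: det_mult[symmetric, of _ n])
  then have "det (circ a) = det D"
    using det_fourier_nonzero[of w n] w prim by (simp add: F_def)
  also have "\<dots> = prod_list (diag_mat D)"
    by (rule det_upper_triangular[where n = n]) (auto simp: D_def)
  also have "\<dots> = (\<Prod>m<n. ev m)"
    by (simp add: diag_mat_def D_def prod.list_conv_set_nth atLeast0LessThan)
  finally show ?thesis by (simp add: ev_def)
qed

lemma cis_primitive_root:
  assumes "n > 0"
  shows "cis (2 * pi / n) ^ n = 1" and "0 < k \<Longrightarrow> k < n \<Longrightarrow> cis (2 * pi / n) ^ k \<noteq> 1"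
proof -
  show "cis (2 * pi / n) ^ n = 1" using assms by (simp add: DeMoivre)
  assume k: "0 < k" "k < n"
  show "cis (2 * pi / n) ^ k \<noteq> 1"
  proof
    assume "cis (2 * pi / n) ^ k = 1"
    \<comment> \<open>The real part suffices: the cosine is 1 only at integer multiples of
      \<open>2 * pi\<close>, so \<open>n\<close> divides \<open>k\<close>.\<close>
    then have "cos (k * (2 * pi / n)) = 1" by (simp add: DeMoivre complex_eq_iff)
    then obtain x :: int where "k * (2 * pi / n) = x * 2 * pi" using cos_one_2pi_int by auto
    then have "real k = real_of_int x * n" using assms by (simp add: field_simps)
    then have "int k = x * int n" by (metis of_int_eq_iff of_int_mult of_int_of_nat_eq)
    then have "n dvd k" by (metis dvd_triv_right int_dvd_int_iff)
    then show False using k nat_dvd_not_less by blast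
  qed
qed

lemma circ_map_vec: "circ (map_vec f a) = map_mat f (circ a)"
  by (cases "dim_vec a = 0") (auto simp: circ_def intro!: eq_matI)

text \<open>The roots of unity are complex, so the real row is embedded first; determinants commute
  with ring homomorphisms.\<close>

lemma of_real_det_circ_eq_prod:
  assumes "a \<in> carrier_vec n" "n > 0"
  shows "complex_of_real (det (circ a)) =
    (\<Prod>m<n. \<Sum>i<n. complex_of_real (a $ i) * (cis (2 * pi / n) ^ m) ^ i)"
proof -
  have "complex_of_real (det (circ a)) = det (circ (map_vec complex_of_real a))"
    by (simp add: circ_map_vec of_real_hom.hom_det)
  also have "\<dots> = (\<Prod>m<n. \<Sum>i<n. map_vec complex_of_real a $ i * (cis (2 * pi / n) ^ m) ^ i)"
    using assms by (intro det_circ_eq_prod cis_primitive_root) auto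
  also have "\<dots> = (\<Prod>m<n. \<Sum>i<n. complex_of_real (a $ i) * (cis (2 * pi / n) ^ m) ^ i)"
    using assms by (intro prod.cong sum.cong) auto
  finally show ?thesis .
qed

section \<open>Maxima and extreme points of the cube\<close>

lemma attains_cube_max_exists: "\<exists>a. attains_cube_max n a"
proof -
  \<comment> \<open>Rows are represented by functions with values in [0,1] on all of
    \<open>nat\<close>; \<open>vec n\<close> ignores the indices from \<open>n\<close> on.
    Compactness of \<open>K\<close> is Tychonoff's theorem.\<close>
  define K where "K = (PiE UNIV (\<lambda>i::nat. {0..1::real}))"
  define g where "g = (\<lambda>f::nat \<Rightarrow> real. \<bar>det (circ (vec n f))\<bar>)"
  have K: "compact K"
    using compactin_PiE[of "\<lambda>_. euclidean" UNIV "\<lambda>i::nat. {0..1::real}"]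
    by (simp add: K_def euclidean_product_topology)
  have g: "continuous_on K g"
  proof -
    \<comment> \<open>The Leibniz formula exhibits \<open>g\<close> as the absolute value of a
      polynomial in finitely many coordinates, hence as continuous.\<close>
    have "g = (\<lambda>f. \<bar>\<Sum>p | p permutes {0..<n}. signof p * (\<Prod>i = 0..<n. f ((p i + n - i) mod n))\<bar>)"
    proof
      fix f :: "nat \<Rightarrow> real"
      have "det (circ (vec n f)) = (\<Sum>p | p permutes {0..<n}. signof p * (\<Prod>i = 0..<n. circ (vec n f) $$ (i, p i)))"
        by (intro det_def' circ_carrier) simp
      also have "\<dots> = (\<Sum>p | p permutes {0..<n}. signof p * (\<Prod>i = 0..<n. f ((p i + n - i) mod n)))"
      proof (intro sum.cong arg_cong2[of _ _ _ _ "(*)"] prod.cong refl)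
        fix p i assume "p \<in> {p. p permutes {0..<n}}" "i \<in> {0..<n}"
        then have "p i < n" "i < n" using permutes_in_image[of p "{0..<n}" i] by auto
        then show "circ (vec n f) $$ (i, p i) = f ((p i + n - i) mod n)"
          by (subst circ_index) auto
      qed
      finally show "g f = \<bar>\<Sum>p | p permutes {0..<n}. signof p * (\<Prod>i = 0..<n. f ((p i + n - i) mod n))\<bar>"
        by (simp add: g_def)
    qed
    moreover have "continuous_on K (\<lambda>f. \<bar>\<Sum>p | p permutes {0..<n}. signof p * (\<Prod>i = 0..<n. f ((p i + n - i) mod n)) :: real\<bar>)"
      by (intro continuous_intros continuous_on_subset[OF continuous_on_product_coordinates]) auto
    ultimately show ?thesis by simp
  qed
  have "K \<noteq> {}" by (auto simp: K_def PiE_eq_empty_iff)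
  then obtain f where f: "f \<in> K" "\<And>h. h \<in> K \<Longrightarrow> g h \<le> g f"
    using continuous_attains_sup[OF K _ g] by auto
  have "\<bar>det (circ b)\<bar> \<le> \<bar>det (circ (vec n f))\<bar>" if "b \<in> unit_cube n" for b
  proof -
    let ?h = "\<lambda>i. if i < n then b $ i else 0"
    have "?h \<in> K" using that by (auto simp: K_def unit_cube_def)
    moreover have "vec n ?h = b" using that by (auto simp: unit_cube_def)
    ultimately show ?thesis using f(2)[of ?h] by (simp add: g_def)
  qed
  moreover have "vec n f \<in> unit_cube n" using f(1) by (auto simp: K_def unit_cube_def PiE_def Pi_def)
  ultimately show ?thesis
    unfolding attains_cube_max_def is_arg_max_linorder by blast
qed

text \<open>If coordinate \<open>i\<close> is strictly between 0 and 1, replacing it by 0 and by 1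
  gives two cube points, and weight \<open>a $ i\<close> on the second recovers \<open>a\<close> as
  a proper convex combination.\<close>

lemma extreme_point_unit_cube:
  assumes "extreme_point a (unit_cube n)"
  shows "a \<in> zero_one_vecs n"
proof (rule ccontr)
  assume "a \<notin> zero_one_vecs n"
  moreover have a: "a \<in> unit_cube n" using assms by (simp add: extreme_point_def)
  ultimately obtain i where i: "i < n" "a $ i \<noteq> 0" "a $ i \<noteq> 1"
    by (auto simp: zero_one_vecs_def unit_cube_def)
  define x where "x = vec n (\<lambda>j. if j = i then 0 else a $ j)"
  define y where "y = vec n (\<lambda>j. if j = i then 1 else a $ j)"
  have "x \<in> unit_cube n" "y \<in> unit_cube n" using a by (auto simp: x_def y_def unit_cube_def)
  moreover have "x $ i \<noteq> y $ i" using i by (simp add: x_def y_def)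
  then have "x \<noteq> y" by auto
  moreover have "0 < a $ i" "a $ i < 1" using a i by (auto simp: unit_cube_def less_le)
  moreover have "a = (1 - a $ i) \<cdot>\<^sub>v x + a $ i \<cdot>\<^sub>v y"
    using a by (intro eq_vecI) (auto simp: x_def y_def unit_cube_def algebra_simps)
  ultimately show False using assms unfolding extreme_point_def by blast
qed

lemma finite_zero_one_vecs: "finite (zero_one_vecs n)"
proof (rule finite_subset)
  show "zero_one_vecs n \<subseteq> vec_of_list ` {xs. set xs \<subseteq> {0, 1} \<and> length xs = n}"
  proof
    fix a assume a: "a \<in> zero_one_vecs n"
    have "a = vec_of_list (list_of_vec a)" by (simp add: vec_list)
    moreover have "set (list_of_vec a) \<subseteq> {0, 1}" "length (list_of_vec a) = n"
      using a by (auto simp: zero_one_vecs_def set_list_of_vec vec_set_def)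
    ultimately show "a \<in> vec_of_list ` {xs. set xs \<subseteq> {0, 1} \<and> length xs = n}" by blast
  qed
qed (simp add: finite_lists_length_eq)

text \<open>A single cube row beating \<open>D01 n\<close> settles every maximiser, so no maximiser
  has to be located.\<close>

lemma cube_max_exceeds_D01:
  assumes "b \<in> unit_cube n" "\<bar>det (circ b)\<bar> > D01 n" "attains_cube_max n a"
  shows "\<bar>det (circ a)\<bar> > D01 n"
  using assms by (force simp: attains_cube_max_def is_arg_max_linorder)

lemma D01_upper: "a \<in> zero_one_vecs n \<Longrightarrow> \<bar>det (circ a)\<bar> \<le> D01 n"
  unfolding D01_def by (intro Max_ge) (auto simp: finite_zero_one_vecs)

section \<open>Polynomial formulas for orders 3, 5, 9 and 10\<close>

definition circ3_det :: "'a::comm_ring_1 \<Rightarrow> 'a \<Rightarrow> 'a \<Rightarrow> 'a" where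
  "circ3_det p q r = p * p * p + q * q * q + r * r * r - 3 * (p * q * r)"

text \<open>For \<open>t ^ 3 = 1\<close>, the coefficients of \<open>1\<close> and \<open>t\<close> in \<open>(x + t y + t\<^sup>2 z)\<^sup>3\<close>; exchanging \<open>y\<close> and
  \<open>z\<close> in the latter gives the coefficient of \<open>t\<^sup>2\<close>.\<close>

definition cube3_0 :: "'a::comm_ring_1 \<Rightarrow> 'a \<Rightarrow> 'a \<Rightarrow> 'a" where
  "cube3_0 x y z = x * x * x + y * y * y + z * z * z + 6 * (x * y * z)"

definition cube3_1 :: "'a::comm_ring_1 \<Rightarrow> 'a \<Rightarrow> 'a \<Rightarrow> 'a" where
  "cube3_1 x y z = 3 * (x * x * y + y * y * z + z * z * x)"

text \<open>The constant coefficient of a product of three elements modulo \<open>t ^ 3 - 1\<close>; the other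
  coefficients arise by rotating the entries of one factor.\<close>

definition triple3 :: "'a::comm_ring_1 \<Rightarrow> 'a \<Rightarrow> 'a \<Rightarrow> 'a \<Rightarrow> 'a \<Rightarrow> 'a \<Rightarrow> 'a \<Rightarrow> 'a \<Rightarrow> 'a \<Rightarrow> 'a" where
  "triple3 x y z x' y' z' x'' y'' z'' =
     x * (x' * x'' + y' * z'' + z' * y'')
   + y * (x' * z'' + y' * y'' + z' * x'')
   + z * (x' * y'' + y' * x'' + z' * z'')"

text \<open>The arguments are the coefficients of 1, t, t^2 in A^3 + t B^3 + t^2 C^3 - 3 t A B C
  modulo t^3 - 1, where A, B, C collect the entries with index 0, 1, 2 modulo 3. The factors t and
  t^2 account for the rotated coefficients.\<close>

definition circ9_det :: "'a::comm_ring_1 \<Rightarrow> 'a \<Rightarrow> 'a \<Rightarrow> 'a \<Rightarrow> 'a \<Rightarrow> 'a \<Rightarrow> 'a \<Rightarrow> 'a \<Rightarrow> 'a \<Rightarrow> 'a" where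
  "circ9_det a0 a1 a2 a3 a4 a5 a6 a7 a8 = circ3_det
     (cube3_0 a0 a3 a6 + cube3_1 a1 a7 a4 + cube3_1 a2 a5 a8 - 3 * triple3 a0 a3 a6 a1 a4 a7 a8 a2 a5)
     (cube3_1 a0 a3 a6 + cube3_0 a1 a4 a7 + cube3_1 a2 a8 a5 - 3 * triple3 a0 a3 a6 a1 a4 a7 a2 a5 a8)
     (cube3_1 a0 a6 a3 + cube3_1 a1 a4 a7 + cube3_0 a2 a5 a8 - 3 * triple3 a0 a3 a6 a1 a4 a7 a5 a8 a2)"

text \<open>Here \<open>s\<close>, \<open>t\<close>, \<open>u\<close> are the cyclic autocorrelations at lags 0, 1, 2, so that the value at \<open>z\<close>
  times the value at the inverse of \<open>z\<close> is \<open>s + (z + z ^ 4) t + (z\<^sup>2 + z ^ 3) u\<close>. This is the product of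
  that number and its conjugate, \<open>z + z ^ 4\<close> and \<open>z\<^sup>2 + z ^ 3\<close> having sum and product \<open>-1\<close>.\<close>

definition circ5_norm :: "'a::comm_ring_1 \<Rightarrow> 'a \<Rightarrow> 'a \<Rightarrow> 'a" where
  "circ5_norm s t u = s * s - s * (t + u) - t * t - u * u + 3 * (t * u)"

definition circ5_det :: "'a::comm_ring_1 \<Rightarrow> 'a \<Rightarrow> 'a \<Rightarrow> 'a \<Rightarrow> 'a \<Rightarrow> 'a" where
  "circ5_det a b c d e = (a + b + c + d + e) * circ5_norm
     (a * a + b * b + c * c + d * d + e * e)
     (a * b + b * c + c * d + d * e + e * a)
     (a * c + c * e + e * b + b * d + d * a)"

text \<open>The constant coefficient of \<open>(a + t b + t\<^sup>2 c + t ^ 3 d + t ^ 4 e)\<^sup>2\<close> modulo \<open>t ^ 5 - 1\<close>.\<close>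

definition square5 :: "'a::comm_ring_1 \<Rightarrow> 'a \<Rightarrow> 'a \<Rightarrow> 'a \<Rightarrow> 'a \<Rightarrow> 'a" where
  "square5 a b c d e = a * a + 2 * (b * e + c * d)"

text \<open>The arguments are the coefficients of E^2 - t D^2 modulo t^5 - 1, where E and D collect
  the entries of even and odd index. The factor t shifts the coefficients of D^2 by one
  place.\<close>

definition circ10_det :: "'a::comm_ring_1 \<Rightarrow> 'a \<Rightarrow> 'a \<Rightarrow> 'a \<Rightarrow> 'a \<Rightarrow> 'a \<Rightarrow> 'a \<Rightarrow> 'a \<Rightarrow> 'a \<Rightarrow> 'a \<Rightarrow> 'a" where
  "circ10_det a0 a1 a2 a3 a4 a5 a6 a7 a8 a9 = circ5_det
     (square5 a0 a2 a4 a6 a8 - square5 a5 a7 a9 a1 a3)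
     (square5 a6 a8 a0 a2 a4 - square5 a1 a3 a5 a7 a9)
     (square5 a2 a4 a6 a8 a0 - square5 a7 a9 a1 a3 a5)
     (square5 a8 a0 a2 a4 a6 - square5 a3 a5 a7 a9 a1)
     (square5 a4 a6 a8 a0 a2 - square5 a9 a1 a3 a5 a7)"

text \<open>The method name is qualified because HOL-Algebra shadows it.\<close>

lemma circ3_det_eq_prod:
  fixes u :: "'a::idom"
  assumes "1 + u + u\<^sup>2 = 0"
  shows "(p + q + r) * (p + u * q + u\<^sup>2 * r) * (p + u\<^sup>2 * q + u * r) = circ3_det p q r"
  unfolding circ3_det_def using assms by Groebner_Basis.algebra

lemma cube3:
  fixes t :: "'a::idom"
  assumes "t ^ 3 = 1"
  shows "(x + t * y + t\<^sup>2 * z) ^ 3 = cube3_0 x y z + t * cube3_1 x y z + t\<^sup>2 * cube3_1 x z y"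
  unfolding cube3_0_def cube3_1_def using assms by Groebner_Basis.algebra

lemma triple3:
  fixes t :: "'a::idom"
  assumes "t ^ 3 = 1"
  shows "(x + t * y + t\<^sup>2 * z) * (x' + t * y' + t\<^sup>2 * z') * (x'' + t * y'' + t\<^sup>2 * z'') =
    triple3 x y z x' y' z' x'' y'' z'' + t * triple3 x y z x' y' z' y'' z'' x'' + t\<^sup>2 * triple3 x y z x' y' z' z'' x'' y''"
  unfolding triple3_def using assms by Groebner_Basis.algebra

lemma square5:
  fixes t :: "'a::idom"
  assumes "t ^ 5 = 1"
  shows "(a + t * b + t\<^sup>2 * c + t ^ 3 * d + t ^ 4 * e)\<^sup>2 = square5 a b c d e + t * square5 d e a b c
    + t\<^sup>2 * square5 b c d e a + t ^ 3 * square5 e a b c d + t ^ 4 * square5 c d e a b"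
  unfolding square5_def using assms by Groebner_Basis.algebra

text \<open>Each root other than 1 is paired with its inverse, which turns the product of values
  into autocorrelations. The two pairs give conjugate numbers, whose product is
  \<open>circ5_norm\<close>.\<close>

lemma circ5_det_eq_prod:
  fixes a b c d e z :: "'a::idom"
  assumes z: "1 + z + z\<^sup>2 + z ^ 3 + z ^ 4 = 0"
  defines "P \<equiv> \<lambda>t. a + t * b + t\<^sup>2 * c + t ^ 3 * d + t ^ 4 * e"
  shows "P 1 * P z * P (z\<^sup>2) * P (z ^ 3) * P (z ^ 4) = circ5_det a b c d e"
proof -
  have z5: "z ^ 5 = 1" using z by Groebner_Basis.algebra
  let ?s = "a * a + b * b + c * c + d * d + e * e"
  let ?t = "a * b + b * c + c * d + d * e + e * a"
  let ?u = "a * c + c * e + e * b + b * d + d * a"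
  have pair: "P y * P (y ^ 4) = ?s + (y + y ^ 4) * ?t + (y\<^sup>2 + y ^ 3) * ?u" if "y ^ 5 = 1" for y
  proof -
    have "y ^ 8 = y ^ 3" "y ^ 12 = y ^ 2" "y ^ 16 = y" using that by Groebner_Basis.algebra+
    then have "P (y ^ 4) = a + y ^ 4 * b + y ^ 3 * c + y ^ 2 * d + y * e"
      by (simp add: P_def flip: power_mult)
    then show ?thesis using that unfolding P_def by Groebner_Basis.algebra
  qed
  \<comment> \<open>For y = z^2 the inverse is z^3, and the sums z + z^4 and z^2 + z^3 trade
    places.\<close>
  have "(z\<^sup>2) ^ 5 = 1" using z5 by Groebner_Basis.algebra
  moreover have "(z\<^sup>2) ^ 4 = z ^ 3" using z5 by Groebner_Basis.algebra
  moreover have "(z\<^sup>2)\<^sup>2 = z ^ 4" by (simp flip: power_mult)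
  moreover have "(z\<^sup>2) ^ 3 = z" using z5 by Groebner_Basis.algebra
  ultimately have pair2: "P (z\<^sup>2) * P (z ^ 3) = ?s + (z\<^sup>2 + z ^ 3) * ?t + (z + z ^ 4) * ?u"
    using pair[of "z\<^sup>2"] by (simp add: add.commute[of "z ^ 4" z])
  have norm: "(s + h * t + k * u) * (s + k * t + h * u) = circ5_norm s t u"
    if "h + k = -1" "h * k = -1" for h k s t u :: 'a
    unfolding circ5_norm_def using that by Groebner_Basis.algebra
  have "(P z * P (z ^ 4)) * (P (z\<^sup>2) * P (z ^ 3)) = circ5_norm ?s ?t ?u"
    unfolding pair[OF z5] pair2 by (rule norm) (use z in Groebner_Basis.algebra)+
  moreover have "P 1 = a + b + c + d + e" by (simp add: P_def)
  ultimately show ?thesis unfolding circ5_det_def by (simp add: mult_ac)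
qed

text \<open>With u = w^3, the nine roots fall into three cosets x, u x, u^2 x, the cube roots of t =
  1, u, u^2. The order 3 formula is applied twice: inside each coset, then across the three values
  of t.\<close>

lemma circ9_det_eq_prod:
  fixes a0 a1 a2 a3 a4 a5 a6 a7 a8 w :: "'a::idom"
  assumes "w ^ 9 = 1" "w ^ 3 \<noteq> 1"
  defines "P \<equiv> \<lambda>x. a0 + a1 * x + a2 * x\<^sup>2 + a3 * x ^ 3 + a4 * x ^ 4 + a5 * x ^ 5 + a6 * x ^ 6 + a7 * x ^ 7 + a8 * x ^ 8"
  shows "P (w ^ 0) * P (w ^ 1) * P (w ^ 2) * P (w ^ 3) * P (w ^ 4) * P (w ^ 5) * P (w ^ 6) * P (w ^ 7) * P (w ^ 8) =
    circ9_det a0 a1 a2 a3 a4 a5 a6 a7 a8"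
proof -
  define u where "u = w ^ 3"
  have u3: "u ^ 3 = 1" using assms(1) by (simp add: u_def flip: power_mult)
  have "(u - 1) * (1 + u + u\<^sup>2) = 0" using u3 by Groebner_Basis.algebra
  then have u: "1 + u + u\<^sup>2 = 0" using assms(2) by (simp add: u_def)
  define p where "p = cube3_0 a0 a3 a6 + cube3_1 a1 a7 a4 + cube3_1 a2 a5 a8 - 3 * triple3 a0 a3 a6 a1 a4 a7 a8 a2 a5"
  define q where "q = cube3_1 a0 a3 a6 + cube3_0 a1 a4 a7 + cube3_1 a2 a8 a5 - 3 * triple3 a0 a3 a6 a1 a4 a7 a2 a5 a8"
  define r where "r = cube3_1 a0 a6 a3 + cube3_1 a1 a4 a7 + cube3_0 a2 a5 a8 - 3 * triple3 a0 a3 a6 a1 a4 a7 a5 a8 a2"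
  have step: "P x * P (u * x) * P (u\<^sup>2 * x) = p + t * q + t\<^sup>2 * r" if "x ^ 3 = t" "t ^ 3 = 1" for x t
  proof -
    define A where "A = a0 + t * a3 + t\<^sup>2 * a6"
    define B where "B = a1 + t * a4 + t\<^sup>2 * a7"
    define C where "C = a2 + t * a5 + t\<^sup>2 * a8"
    have split: "P y = A + y * B + y\<^sup>2 * C" if "y ^ 3 = t" for y
      unfolding P_def A_def B_def C_def that[symmetric] by Groebner_Basis.algebra
    have "(u\<^sup>2) ^ 3 = 1" using u3 by Groebner_Basis.algebra
    then have "(u * x) ^ 3 = t" "(u\<^sup>2 * x) ^ 3 = t" using that u3 by (simp_all add: power_mult_distrib)
    then have "P x * P (u * x) * P (u\<^sup>2 * x) =
        (A + x * B + x\<^sup>2 * C) * (A + u * x * B + (u * x)\<^sup>2 * C) * (A + u\<^sup>2 * x * B + (u\<^sup>2 * x)\<^sup>2 * C)"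
      using split that by simp
    \<comment> \<open>Since u^4 = u, these are the three factors of the order 3 circulant with row
      A, x B, x^2 C.\<close>
    also have "\<dots> = (A + x * B + x\<^sup>2 * C) * (A + u * (x * B) + u\<^sup>2 * (x\<^sup>2 * C)) * (A + u\<^sup>2 * (x * B) + u * (x\<^sup>2 * C))"
    proof -
      have "u ^ 4 = u" using u3 by Groebner_Basis.algebra
      then show ?thesis by (simp add: power_mult_distrib mult_ac flip: power_mult)
    qed
    also have "\<dots> = circ3_det A (x * B) (x\<^sup>2 * C)" by (rule circ3_det_eq_prod[OF u])
    \<comment> \<open>In \<open>circ3_det\<close> every occurrence of x combines into powers of x^3
      = t.\<close>
    also have "\<dots> = A ^ 3 + t * B ^ 3 + t\<^sup>2 * C ^ 3 - 3 * t * (A * B * C)"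
      unfolding circ3_det_def \<open>x ^ 3 = t\<close>[symmetric] by Groebner_Basis.algebra
    also have "\<dots> = p + t * q + t\<^sup>2 * r"
      unfolding A_def B_def C_def cube3[OF that(2)] triple3[OF that(2)] p_def q_def r_def
      using that(2) by Groebner_Basis.algebra
    finally show ?thesis .
  qed
  \<comment> \<open>The exponents are regrouped by their residue modulo 3.\<close>
  have "P (w ^ 0) * P (w ^ 1) * P (w ^ 2) * P (w ^ 3) * P (w ^ 4) * P (w ^ 5) * P (w ^ 6) * P (w ^ 7) * P (w ^ 8) =
     (P 1 * P (u * 1) * P (u\<^sup>2 * 1)) * (P w * P (u * w) * P (u\<^sup>2 * w)) * (P (w\<^sup>2) * P (u * w\<^sup>2) * P (u\<^sup>2 * w\<^sup>2))"
    by (simp add: u_def mult_ac flip: power_mult power_add power_Suc power_Suc2)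
  also have "\<dots> = (p + q + r) * (p + u * q + u\<^sup>2 * r) * (p + u\<^sup>2 * q + u * r)"
  proof -
    have "u ^ 4 = u" "u ^ 6 = 1" using u3 by Groebner_Basis.algebra+
    moreover have "(w\<^sup>2) ^ 3 = u\<^sup>2" by (simp add: u_def flip: power_mult)
    ultimately show ?thesis using step[of 1 1] step[of w u] step[of "w\<^sup>2" "u\<^sup>2"] u3 by (simp add: u_def[symmetric] flip: power_mult)
  qed
  also have "\<dots> = circ9_det a0 a1 a2 a3 a4 a5 a6 a7 a8"
    unfolding circ3_det_eq_prod[OF u] circ9_det_def p_def q_def r_def ..
  finally show ?thesis .
qed

text \<open>Here w^5 = -1, so the exponents k and k + 5 give opposite arguments. P(x) P(-x) depends
  only on x^2, which leaves a product over the powers of z = w^2, a case of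
  \<open>circ5_det_eq_prod\<close>.\<close>

lemma circ10_det_eq_prod:
  fixes a0 a1 a2 a3 a4 a5 a6 a7 a8 a9 w :: "'a::idom"
  assumes "w ^ 10 = 1" "w ^ 2 \<noteq> 1" "w ^ 5 \<noteq> 1"
  defines "P \<equiv> \<lambda>x. a0 + a1 * x + a2 * x\<^sup>2 + a3 * x ^ 3 + a4 * x ^ 4 + a5 * x ^ 5 + a6 * x ^ 6 + a7 * x ^ 7 + a8 * x ^ 8 + a9 * x ^ 9"
  shows "P (w ^ 0) * P (w ^ 1) * P (w ^ 2) * P (w ^ 3) * P (w ^ 4) * P (w ^ 5) * P (w ^ 6) * P (w ^ 7) * P (w ^ 8) * P (w ^ 9) =
    circ10_det a0 a1 a2 a3 a4 a5 a6 a7 a8 a9"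
proof -
  define z where "z = w\<^sup>2"
  have z5: "z ^ 5 = 1" using assms(1) by (simp add: z_def flip: power_mult)
  have "(z - 1) * (1 + z + z\<^sup>2 + z ^ 3 + z ^ 4) = 0" using z5 by Groebner_Basis.algebra
  then have z: "1 + z + z\<^sup>2 + z ^ 3 + z ^ 4 = 0" using assms(2) by (simp add: z_def)
  have "(w ^ 5 - 1) * (w ^ 5 + 1) = 0" using assms(1) by Groebner_Basis.algebra
  then have w5: "w ^ 5 = - 1" using assms(3) by (auto simp: eq_neg_iff_add_eq_0)
  define b0 where "b0 = square5 a0 a2 a4 a6 a8 - square5 a5 a7 a9 a1 a3"
  define b1 where "b1 = square5 a6 a8 a0 a2 a4 - square5 a1 a3 a5 a7 a9"
  define b2 where "b2 = square5 a2 a4 a6 a8 a0 - square5 a7 a9 a1 a3 a5"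
  define b3 where "b3 = square5 a8 a0 a2 a4 a6 - square5 a3 a5 a7 a9 a1"
  define b4 where "b4 = square5 a4 a6 a8 a0 a2 - square5 a9 a1 a3 a5 a7"
  define Q where "Q = (\<lambda>t. b0 + t * b1 + t\<^sup>2 * b2 + t ^ 3 * b3 + t ^ 4 * b4)"
  have step: "P x * P y = Q t" if "t ^ 5 = 1" "x\<^sup>2 = t" "y = - x" for x y t
  proof -
    define E where "E = a0 + t * a2 + t\<^sup>2 * a4 + t ^ 3 * a6 + t ^ 4 * a8"
    define D where "D = a1 + t * a3 + t\<^sup>2 * a5 + t ^ 3 * a7 + t ^ 4 * a9"
    have split: "P v = E + v * D" if "v\<^sup>2 = t" for v
      unfolding P_def E_def D_def that[symmetric] by Groebner_Basis.algebra
    have "P x * P y = (E + x * D) * (E - x * D)"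
      using split[of x] split[of y] that by simp
    also have "\<dots> = E\<^sup>2 - t * D\<^sup>2" using that by Groebner_Basis.algebra
    also have "\<dots> = Q t"
      unfolding E_def D_def square5[OF that(1)] Q_def b0_def b1_def b2_def b3_def b4_def
      using that(1) by Groebner_Basis.algebra
    finally show ?thesis .
  qed
  have pair: "P (w ^ k) * P (w ^ (k + 5)) = Q (z ^ k)" for k
  proof (rule step)
    show "(z ^ k) ^ 5 = 1" by (metis power_mult mult.commute z5 power_one)
    show "(w ^ k)\<^sup>2 = z ^ k" by (simp add: z_def mult.commute flip: power_mult)
    show "w ^ (k + 5) = - (w ^ k)" by (simp add: power_add w5)
  qed
  have "P (w ^ 0) * P (w ^ 1) * P (w ^ 2) * P (w ^ 3) * P (w ^ 4) * P (w ^ 5) * P (w ^ 6) * P (w ^ 7) * P (w ^ 8) * P (w ^ 9) =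
      (P (w ^ 0) * P (w ^ (0 + 5))) * (P (w ^ 1) * P (w ^ (1 + 5))) * (P (w ^ 2) * P (w ^ (2 + 5)))
      * (P (w ^ 3) * P (w ^ (3 + 5))) * (P (w ^ 4) * P (w ^ (4 + 5)))"
    by (simp add: mult_ac)
  also have "\<dots> = Q 1 * Q z * Q (z\<^sup>2) * Q (z ^ 3) * Q (z ^ 4)"
    unfolding pair by simp
  also have "\<dots> = circ10_det a0 a1 a2 a3 a4 a5 a6 a7 a8 a9"
    unfolding Q_def circ5_det_eq_prod[OF z] circ10_det_def b0_def b1_def b2_def b3_def b4_def ..
  finally show ?thesis .
qed

section \<open>Exhaustive evaluation and transfer to real rows\<close>

text \<open>All 512 rows are evaluated in integer arithmetic by rewriting.\<close>

lemma circ9_det_zero_one: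
  "\<forall>a0\<in>{0,1}. \<forall>a1\<in>{0,1}. \<forall>a2\<in>{0,1}. \<forall>a3\<in>{0,1}. \<forall>a4\<in>{0,1}. \<forall>a5\<in>{0,1}. \<forall>a6\<in>{0,1}. \<forall>a7\<in>{0,1}.
    \<forall>a8\<in>{0,1::int}. \<bar>circ9_det a0 a1 a2 a3 a4 a5 a6 a7 a8\<bar> \<le> 95"
  by code_simp

lemma circ10_det_zero_one:
  "\<forall>a0\<in>{0,1}. \<forall>a1\<in>{0,1}. \<forall>a2\<in>{0,1}. \<forall>a3\<in>{0,1}. \<forall>a4\<in>{0,1}. \<forall>a5\<in>{0,1}. \<forall>a6\<in>{0,1}. \<forall>a7\<in>{0,1}.
    \<forall>a8\<in>{0,1}. \<forall>a9\<in>{0,1::int}. \<bar>circ10_det a0 a1 a2 a3 a4 a5 a6 a7 a8 a9\<bar> \<le> 275"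
  by code_simp

text \<open>The product over the ninth roots of unity is a complex identity between images of real
  numbers, so it descends to the reals by injectivity of the embedding.\<close>

lemma det_circ_9:
  assumes "a \<in> carrier_vec 9"
  shows "det (circ a) = circ9_det (a $ 0) (a $ 1) (a $ 2) (a $ 3) (a $ 4) (a $ 5) (a $ 6) (a $ 7) (a $ 8 :: real)"
proof -
  define w where "w = cis (2 * pi / real (9::nat))"
  have w: "w ^ 9 = 1" "w ^ 3 \<noteq> 1"
    unfolding w_def using cis_primitive_root(1)[of 9] cis_primitive_root(2)[of 9 3]
    by simp_all
  have sum9: "(\<Sum>i<9. f i) = f 0 + f 1 + f 2 + f 3 + f 4 + f 5 + f 6 + f 7 + f 8" for f :: "nat \<Rightarrow> complex"
    by (simp add: eval_nat_numeral)
  have prod9: "(\<Prod>i<9. f i) = f 0 * f 1 * f 2 * f 3 * f 4 * f 5 * f 6 * f 7 * f 8" for f :: "nat \<Rightarrow> complex"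
    by (simp add: eval_nat_numeral)
  have "complex_of_real (det (circ a)) = (\<Prod>m<9. \<Sum>i<9. complex_of_real (a $ i) * (w ^ m) ^ i)"
    unfolding w_def by (rule of_real_det_circ_eq_prod) (use assms in auto)
  also have "\<dots> = circ9_det (complex_of_real (a $ 0)) (a $ 1) (a $ 2) (a $ 3) (a $ 4) (a $ 5) (a $ 6) (a $ 7) (a $ 8)"
    unfolding prod9 sum9 circ9_det_eq_prod[OF w, symmetric] by (simp only: power_0 power_one_right mult_1_right)
  also have "\<dots> = complex_of_real (circ9_det (a $ 0) (a $ 1) (a $ 2) (a $ 3) (a $ 4) (a $ 5) (a $ 6) (a $ 7) (a $ 8))"
    by (simp add: circ9_det_def circ3_det_def cube3_0_def cube3_1_def triple3_def)
  finally show ?thesis by (simp only: of_real_eq_iff)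
qed

lemma det_circ_10:
  assumes "a \<in> carrier_vec 10"
  shows "det (circ a) = circ10_det (a $ 0) (a $ 1) (a $ 2) (a $ 3) (a $ 4) (a $ 5) (a $ 6) (a $ 7) (a $ 8) (a $ 9 :: real)"
proof -
  define w where "w = cis (2 * pi / real (10::nat))"
  have w: "w ^ 10 = 1" "w ^ 2 \<noteq> 1" "w ^ 5 \<noteq> 1"
    unfolding w_def using cis_primitive_root(1)[of 10] cis_primitive_root(2)[of 10 2] cis_primitive_root(2)[of 10 5]
    by simp_all
  have sum10: "(\<Sum>i<10. f i) = f 0 + f 1 + f 2 + f 3 + f 4 + f 5 + f 6 + f 7 + f 8 + f 9" for f :: "nat \<Rightarrow> complex"
    by (simp add: eval_nat_numeral)
  have prod10: "(\<Prod>i<10. f i) = f 0 * f 1 * f 2 * f 3 * f 4 * f 5 * f 6 * f 7 * f 8 * f 9" for f :: "nat \<Rightarrow> complex"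
    by (simp add: eval_nat_numeral)
  have "complex_of_real (det (circ a)) = (\<Prod>m<10. \<Sum>i<10. complex_of_real (a $ i) * (w ^ m) ^ i)"
    unfolding w_def by (rule of_real_det_circ_eq_prod) (use assms in auto)
  also have "\<dots> = circ10_det (complex_of_real (a $ 0)) (a $ 1) (a $ 2) (a $ 3) (a $ 4) (a $ 5) (a $ 6) (a $ 7) (a $ 8) (a $ 9)"
    unfolding prod10 sum10 circ10_det_eq_prod[OF w, symmetric] by (simp only: power_0 power_one_right mult_1_right)
  also have "\<dots> = complex_of_real (circ10_det (a $ 0) (a $ 1) (a $ 2) (a $ 3) (a $ 4) (a $ 5) (a $ 6) (a $ 7) (a $ 8) (a $ 9))"
    by (simp add: circ10_det_def circ5_det_def circ5_norm_def square5_def)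
  finally show ?thesis by (simp only: of_real_eq_iff)
qed

lemma det_circ_9_zero_one:
  assumes a: "a \<in> zero_one_vecs 9"
  shows "\<bar>det (circ a)\<bar> \<le> 95"
proof -
  \<comment> \<open>An integer copy of the row, so that the bound evaluated over the integers
    applies.\<close>
  define b where "b = (\<lambda>i. if a $ i = 1 then 1 else 0 :: int)"
  have b: "b i \<in> {0, 1}" "a $ i = of_int (b i)" if "i < 9" for i
    using a that by (auto simp: zero_one_vecs_def b_def)
  have "det (circ a) = circ9_det (a $ 0) (a $ 1) (a $ 2) (a $ 3) (a $ 4) (a $ 5) (a $ 6) (a $ 7) (a $ 8)"
    using a by (intro det_circ_9) (simp add: zero_one_vecs_def)
  also have "\<dots> = of_int (circ9_det (b 0) (b 1) (b 2) (b 3) (b 4) (b 5) (b 6) (b 7) (b 8))"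
    by (simp add: b circ9_det_def circ3_det_def cube3_0_def cube3_1_def triple3_def)
  finally have det: "det (circ a) = of_int (circ9_det (b 0) (b 1) (b 2) (b 3) (b 4) (b 5) (b 6) (b 7) (b 8))" .
  have "\<bar>circ9_det (b 0) (b 1) (b 2) (b 3) (b 4) (b 5) (b 6) (b 7) (b 8)\<bar> \<le> 95"
    by (intro circ9_det_zero_one[rule_format] b) simp_all
  then show ?thesis unfolding det by linarith
qed

lemma det_circ_10_zero_one:
  assumes a: "a \<in> zero_one_vecs 10"
  shows "\<bar>det (circ a)\<bar> \<le> 275"
proof -
  define b where "b = (\<lambda>i. if a $ i = 1 then 1 else 0 :: int)"
  have b: "b i \<in> {0, 1}" "a $ i = of_int (b i)" if "i < 10" for i
    using a that by (auto simp: zero_one_vecs_def b_def)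
  have "det (circ a) = circ10_det (a $ 0) (a $ 1) (a $ 2) (a $ 3) (a $ 4) (a $ 5) (a $ 6) (a $ 7) (a $ 8) (a $ 9)"
    using a by (intro det_circ_10) (simp add: zero_one_vecs_def)
  also have "\<dots> = of_int (circ10_det (b 0) (b 1) (b 2) (b 3) (b 4) (b 5) (b 6) (b 7) (b 8) (b 9))"
    by (simp add: b circ10_det_def circ5_det_def circ5_norm_def square5_def)
  finally have det: "det (circ a) = of_int (circ10_det (b 0) (b 1) (b 2) (b 3) (b 4) (b 5) (b 6) (b 7) (b 8) (b 9))" .
  have "\<bar>circ10_det (b 0) (b 1) (b 2) (b 3) (b 4) (b 5) (b 6) (b 7) (b 8) (b 9)\<bar> \<le> 275"
    by (intro circ10_det_zero_one[rule_format] b) simp_all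
  then show ?thesis unfolding det by linarith
qed

section \<open>The two one-parameter families and the comparison with 0/1 rows\<close>

lemma det_A9: "det (A9 x) = circ9_det x 0 0 1 1 1 1 0 1"
  unfolding A9_def
  by (subst det_circ_9) (auto simp: vec_of_list_index carrier_dim_vec simp del: vec_of_list_Cons)

lemma det_A10: "det (A10 x) = circ10_det x 0 1 0 0 1 1 1 1 0"
  unfolding A10_def
  by (subst det_circ_10) (auto simp: vec_of_list_index carrier_dim_vec simp del: vec_of_list_Cons)

lemma vec_of_list_in_unit_cube_iff:
  "length xs = n \<Longrightarrow> vec_of_list xs \<in> unit_cube n \<longleftrightarrow> (\<forall>x\<in>set xs. 0 \<le> x \<and> x \<le> 1)"
  by (auto intro!: carrier_vecI simp: unit_cube_def vec_of_list_index all_set_conv_all_nth)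

lemma vec_of_list_in_zero_one_vecs_iff:
  "length xs = n \<Longrightarrow> vec_of_list xs \<in> zero_one_vecs n \<longleftrightarrow> (\<forall>x\<in>set xs. x \<in> {0, 1})"
  by (auto intro!: carrier_vecI simp: zero_one_vecs_def vec_of_list_index all_set_conv_all_nth)

lemma D01_eqI:
  assumes "a \<in> zero_one_vecs n" "\<bar>det (circ a)\<bar> = m"
    and "\<And>b. b \<in> zero_one_vecs n \<Longrightarrow> \<bar>det (circ b)\<bar> \<le> m"
  shows "D01 n = m"
  unfolding D01_def
  by (rule Max_eqI) (use assms in \<open>auto simp: finite_zero_one_vecs image_iff\<close>)

theorem mainTheorem2:
  shows "\<not> (\<forall>n>0. \<exists>a. extreme_point a (unit_cube n) \<and> attains_cube_max n a) \<and>
    (det (A9 0) = 95 \<and> D01 9 = 95 \<and>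
      ((\<lambda>x. det (A9 x)) has_real_derivative 9) (at 0) \<and>
      \<bar>det (A9 0.241)\<bar> > 96.757 \<and>
      (\<exists>a. attains_cube_max 9 a \<and> \<bar>det (circ a)\<bar> > D01 9)) \<and>
    (det (A10 0) = 275 \<and> D01 10 = 275 \<and>
      det (A10 0.112) > 279.4 \<and>
      (\<exists>a. attains_cube_max 10 a \<and> \<bar>det (circ a)\<bar> > D01 10))"
proof -
  have cube9: "vec_of_list [x, 0, 0, 1, 1, 1, 1, 0, 1] \<in> unit_cube 9" if "0 \<le> x" "x \<le> 1" for x
    by (subst vec_of_list_in_unit_cube_iff) (use that in simp_all)
  have cube10: "vec_of_list [x, 0, 1, 0, 0, 1, 1, 1, 1, 0] \<in> unit_cube 10" if "0 \<le> x" "x \<le> 1" for x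
    by (subst vec_of_list_in_unit_cube_iff) (use that in simp_all)
  have A9_0: "det (A9 0) = 95"
    by (simp add: det_A9 circ9_det_def circ3_det_def cube3_0_def cube3_1_def triple3_def)
  have A10_0: "det (A10 0) = 275"
    by (simp add: det_A10 circ10_det_def circ5_det_def circ5_norm_def square5_def)
  \<comment> \<open>The evaluated upper bound is attained by the first row of
    \<open>A9 0\<close>.\<close>
  have D9: "D01 9 = 95"
  proof (rule D01_eqI[OF _ _ det_circ_9_zero_one])
    show "vec_of_list [0, 0, 0, 1, 1, 1, 1, 0, 1] \<in> zero_one_vecs 9"
      by (subst vec_of_list_in_zero_one_vecs_iff) simp_all
    show "\<bar>det (circ (vec_of_list [0, 0, 0, 1, 1, 1, 1, 0, 1 :: real]))\<bar> = 95"
      using A9_0 by (simp add: A9_def)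
  qed
  have D10: "D01 10 = 275"
  proof (rule D01_eqI[OF _ _ det_circ_10_zero_one])
    show "vec_of_list [0, 0, 1, 0, 0, 1, 1, 1, 1, 0] \<in> zero_one_vecs 10"
      by (subst vec_of_list_in_zero_one_vecs_iff) simp_all
    show "\<bar>det (circ (vec_of_list [0, 0, 1, 0, 0, 1, 1, 1, 1, 0 :: real]))\<bar> = 275"
      using A10_0 by (simp add: A10_def)
  qed
  have deriv: "((\<lambda>x. det (A9 x)) has_real_derivative 9) (at 0)"
    unfolding det_A9 circ9_det_def circ3_det_def cube3_0_def cube3_1_def triple3_def
    by (auto intro!: derivative_eq_intros)
  have A9_241: "\<bar>det (A9 0.241)\<bar> > 96.757"
    by (simp add: det_A9 circ9_det_def circ3_det_def cube3_0_def cube3_1_def triple3_def)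
  have A10_112: "det (A10 0.112) > 279.4"
    by (simp add: det_A10 circ10_det_def circ5_det_def circ5_norm_def square5_def)
  \<comment> \<open>The row of \<open>A9 0.241\<close> lies in the cube and already exceeds
    95.\<close>
  have max9: "\<bar>det (circ a)\<bar> > D01 9" if "attains_cube_max 9 a" for a
    by (rule cube_max_exceeds_D01[OF cube9[of "0.241"] _ that])
      (use A9_241 in \<open>simp_all add: D9 A9_def\<close>)
  have max10: "\<bar>det (circ a)\<bar> > D01 10" if "attains_cube_max 10 a" for a
    by (rule cube_max_exceeds_D01[OF cube10[of "0.112"] _ that])
      (use A10_112 in \<open>simp_all add: D10 A10_def\<close>)
  \<comment> \<open>The case n = 9 refutes the general claim: an extreme point is a 0/1 row, so its
    value is at most \<open>D01 9\<close>, below that of every maximiser.\<close>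
  have "\<not> (\<exists>a. extreme_point a (unit_cube 9) \<and> attains_cube_max 9 a)"
    using max9 D01_upper extreme_point_unit_cube by (meson not_le)
  then have "\<not> (\<forall>n>0. \<exists>a. extreme_point a (unit_cube n) \<and> attains_cube_max n a)"
    by (metis zero_less_numeral)
  then show ?thesis
    using A9_0 D9 deriv A9_241 A10_0 D10 A10_112 attains_cube_max_exists max9 max10 by blast
qed

end
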